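(* Let $\mathbb{G}=\langle \mathcal{I},A,T,\{l^i\}_{i\in\mathcal{I}},P,\mathcal{R}\rangle$ be a risk-averse game with incomplete information, with $\mathcal{R}=\{\rho^1,\dots,\rho^I\}$. Suppose that for each player $i\in\mathcal{I}$ the ex ante risk preference $\rho^i:\mathcal{L}^\infty(T,\mathcal{F},P)\to\mathbb{R}$ satisfies (i) monotonicity: $\rho^i(L_1)\le\rho^i(L_2)$ whenever $L_1\le L_2$ almost surely; and (ii) convexity: $\rho^i((1-\alpha)L_1+\alpha L_2)\le(1-\alpha)\rho^i(L_1)+\alpha\rho^i(L_2)$ for all $L_1,L_2\in\mathcal{L}^\infty(T,\mathcal{F},P)$ and $0\le\alpha\le1$. Then a risk-averse Nash equilibrium (RANE) exists in $\mathbb{G}$.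
   Context: Game. $\mathcal{I}=\{1,\dots,I\}$, $I\ge2$, is a finite set of players. Each player $i$ has a non-empty finite set of types $T_i$ and a non-empty finite set of actions $A_i$; $T=\prod_i T_i$, $A=\prod_i A_i$. $\mathcal{F}$ is the $\sigma$-algebra of all subsets of $T$, and $P$ is a fully supported probability measure on $(T,\mathcal{F})$ (the common prior). Player $i$ has a bounded loss function $l^i:T\times A\to\mathbb{R}$; players minimize losses. $\mathcal{R}=\{\rho^1,\dots,\rho^I\}$ is the ex ante risk preference profile, where $\rho^i:\mathcal{L}^\infty(T,\mathcal{F},P)\to\mathbb{R}$ is the risk functional of player $i$. Strategies. A (mixed/behavioral) strategy of player $i$ is a map $\beta_i:T_i\to\Delta(A_i)$, where $\Delta(A_i)$ is the set of probability distributions on $A_i$; $\beta_i(a_i|t_i)$ is the probability of action $a_i$ at type $t_i$. $\Sigma_i$ is the set of strategies of $i$ and $\Sigma=\prod_i\Sigma_i$. For $\beta\in\Sigma$, $\beta_{-i}$ is the profile of the other players' strategies and $(\beta_i',\beta_{-i})$ is $\beta$ with $\beta_i$ replaced by $\beta_i'$. Random loss. For $\beta\in\Sigma$, $L^i_\beta$ is the random variable on $T$ given by $L^i_\beta(t)=L^i(t,\beta)=\sum_{a\in A}l^i(t,a)\prod_{j\in\mathcal{I}}\beta_j(a_j|t_j)$. RANE. $\beta^*\in\Sigma$ is a risk-averse Nash equilibrium if for each $i\in\mathcal{I}$, $\rho^i(L^i_{\beta^*})\le\rho^i(L^i_{(\beta_i,\beta^*_{-i})})$ for all $\beta_i\in\Sigma_i$.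 *)

theory Defs
  imports "HOL-Probability.Probability"
begin

(* L^infinity is represented by functions rather than by almost-sure equivalence classes. A
   functional on it that is monotone with respect to the almost-sure order takes equal values
   on almost surely equal functions, so it descends to the classes. *)
definition Linf :: "'b measure \<Rightarrow> ('b \<Rightarrow> real) set" where
  "Linf M = {f \<in> borel_measurable M. \<exists>C. AE x in M. \<bar>f x\<bar> \<le> C}"

(* The type and action sets of all players are subsets of the common ambient types 't and 'a.
   Component functions are only relevant at player indices in {1..num_players G}. *)
record ('t, 'a) game =
  num_players :: nat
  act_set :: "nat \<Rightarrow> 'a set"
  type_set :: "nat \<Rightarrow> 't set"
  loss :: "nat \<Rightarrow> (nat \<Rightarrow> 't) \<Rightarrow> (nat \<Rightarrow> 'a) \<Rightarrow> real"
  prior :: "(nat \<Rightarrow> 't) measure"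
  risk :: "nat \<Rightarrow> ((nat \<Rightarrow> 't) \<Rightarrow> real) \<Rightarrow> real"

definition players :: "('t, 'a) game \<Rightarrow> nat set" where
  "players G = {1..num_players G}"

definition type_profiles :: "('t, 'a) game \<Rightarrow> (nat \<Rightarrow> 't) set" where
  "type_profiles G = (\<Pi>\<^sub>E i\<in>players G. type_set G i)"

definition act_profiles :: "('t, 'a) game \<Rightarrow> (nat \<Rightarrow> 'a) set" where
  "act_profiles G = (\<Pi>\<^sub>E i\<in>players G. act_set G i)"

definition risk_averse_game :: "('t, 'a) game \<Rightarrow> bool" where
  "risk_averse_game G \<longleftrightarrow>
     num_players G \<ge> 2 \<and>
     (\<forall>i\<in>players G. finite (type_set G i) \<and> type_set G i \<noteq> {}) \<and>
     (\<forall>i\<in>players G. finite (act_set G i) \<and> act_set G i \<noteq> {}) \<and>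
     (\<forall>i\<in>players G.
        bounded ((\<lambda>(t, a). loss G i t a) ` (type_profiles G \<times> act_profiles G))) \<and>
     prob_space (prior G) \<and>
     space (prior G) = type_profiles G \<and>
     sets (prior G) = Pow (type_profiles G) \<and>
     (\<forall>t\<in>type_profiles G. measure (prior G) {t} > 0)"

definition strategies :: "('t, 'a) game \<Rightarrow> nat \<Rightarrow> ('t \<Rightarrow> 'a pmf) set" where
  "strategies G i = (type_set G i \<rightarrow>\<^sub>E {p. set_pmf p \<subseteq> act_set G i})"

definition strategy_profiles :: "('t, 'a) game \<Rightarrow> (nat \<Rightarrow> 't \<Rightarrow> 'a pmf) set" where
  "strategy_profiles G = (\<Pi>\<^sub>E i\<in>players G. strategies G i)"

definition random_loss ::
    "('t, 'a) game \<Rightarrow> nat \<Rightarrow> (nat \<Rightarrow> 't \<Rightarrow> 'a pmf) \<Rightarrow> (nat \<Rightarrow> 't) \<Rightarrow> real" where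
  "random_loss G i \<beta> t =
     (\<Sum>a\<in>act_profiles G. loss G i t a * (\<Prod>j\<in>players G. pmf (\<beta> j (t j)) (a j)))"

definition RANE :: "('t, 'a) game \<Rightarrow> (nat \<Rightarrow> 't \<Rightarrow> 'a pmf) \<Rightarrow> bool" where
  "RANE G \<beta> \<longleftrightarrow>
     \<beta> \<in> strategy_profiles G \<and>
     (\<forall>i\<in>players G. \<forall>b\<in>strategies G i.
        risk G i (random_loss G i \<beta>) \<le> risk G i (random_loss G i (\<beta>(i := b))))"

definition monotone_risk :: "'b measure \<Rightarrow> (('b \<Rightarrow> real) \<Rightarrow> real) \<Rightarrow> bool" where
  "monotone_risk M \<rho> \<longleftrightarrow>
     (\<forall>L1\<in>Linf M. \<forall>L2\<in>Linf M. (AE x in M. L1 x \<le> L2 x) \<longrightarrow> \<rho> L1 \<le> \<rho> L2)"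

definition convex_risk :: "'b measure \<Rightarrow> (('b \<Rightarrow> real) \<Rightarrow> real) \<Rightarrow> bool" where
  "convex_risk M \<rho> \<longleftrightarrow>
     (\<forall>L1\<in>Linf M. \<forall>L2\<in>Linf M. \<forall>\<alpha>::real. 0 \<le> \<alpha> \<and> \<alpha> \<le> 1 \<longrightarrow>
        \<rho> (\<lambda>x. (1 - \<alpha>) * L1 x + \<alpha> * L2 x) \<le> (1 - \<alpha>) * \<rho> L1 + \<alpha> * \<rho> L2)"

end

theory Submission imports Defs begin

text \<open>A monotone convex functional of a random variable on a finite space is continuous, so the
  cost of each player is continuous in the strategy profile, and it is convex in the own strategy
  because the random loss is affine in it.  The sum over the players of the gains from unilateral
  deviations (the Nikaido--Isoda function) is therefore continuous in the profile, concave in the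
  deviation and zero on the diagonal; the Ky Fan inequality, which follows from Brouwer's theorem,
  yields a profile at which no deviation gains.\<close>

section \<open>Brouwer's theorem on a cube of variable dimension\<close>

lemma compact_unit_cube: "compact ((UNIV :: 'i set) \<rightarrow> {0..1::real})"
proof -
  have "compactin (product_topology (\<lambda>_. euclidean) UNIV) (PiE (UNIV :: 'i set) (\<lambda>_. {0..1::real}))"
    by (subst compactin_PiE) (simp add: compactin_euclidean_iff)
  then show ?thesis
    by (simp add: euclidean_product_topology PiE_UNIV_domain)
qed

lemma tendsto_fun_componentwise:
  fixes f :: "'b \<Rightarrow> 'i \<Rightarrow> 'c::topological_space"
  assumes "\<And>i. ((\<lambda>x. f x i) \<longlongrightarrow> l i) F"
  shows "(f \<longlongrightarrow> l) F"
proof -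
  have "limitin (product_topology (\<lambda>_. euclidean) UNIV) f l F"
    by (subst limitin_componentwise) (simp add: assms)
  then show ?thesis by (simp add: euclidean_product_topology)
qed

text \<open>The distribution's Brouwer theorem fixes the dimension by a type, whereas here the
  dimension is the length of a finite subcover.  Hence the cube is taken inside
  \<^typ>\<open>nat \<Rightarrow> real\<close> and the fixed point is rederived from Kuhn's combinatorial lemma.\<close>

lemma brouwer_unit_cube_fun:
  fixes f :: "(nat \<Rightarrow> real) \<Rightarrow> nat \<Rightarrow> real" and n :: nat
  assumes cont: "\<And>i. i < n \<Longrightarrow> continuous_on (UNIV \<rightarrow> {0..1}) (\<lambda>x. f x i)"
    and range: "\<And>x i. x \<in> UNIV \<rightarrow> {0..1} \<Longrightarrow> i < n \<Longrightarrow> f x i \<in> {0..1}"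
  obtains x where "x \<in> UNIV \<rightarrow> {0..1}" "\<And>i. i < n \<Longrightarrow> f x i = x i"
proof -
  let ?C = "UNIV \<rightarrow> {0..1} :: (nat \<Rightarrow> real) set"
  \<comment> \<open>The grid point with integer coordinates \<open>r\<close> and mesh
    \<open>1 / Suc m\<close>. Coordinates from \<open>n\<close> on are set to 0, which places the
    finite-dimensional grid inside the infinite cube.\<close>
  define pt where "pt m r = (\<lambda>j. if j < n then real (r j) / real (Suc m) else 0)" for m and r :: "nat \<Rightarrow> nat"
  have pt_C: "pt m r \<in> ?C" if "\<forall>j<n. r j \<le> Suc m" for m r
    using that by (auto simp: pt_def)
  \<comment> \<open>\<open>q\<close> is the lower corner of a grid cell; in direction
    \<open>i\<close>, \<open>f\<close> does not lower the coordinate at the vertex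
    \<open>R i\<close> and does not raise it at the vertex \<open>S i\<close>.\<close>
  define ok where "ok m q R S \<longleftrightarrow> (\<forall>i<n. q i \<le> Suc m) \<and>
      (\<forall>i<n. (\<forall>j<n. q j \<le> R i j \<and> R i j \<le> q j + 1 \<and> R i j \<le> Suc m) \<and>
             (\<forall>j<n. q j \<le> S i j \<and> S i j \<le> q j + 1 \<and> S i j \<le> Suc m) \<and>
             pt m (R i) i \<le> f (pt m (R i)) i \<and> f (pt m (S i)) i \<le> pt m (S i) i)"
    for m q and R S :: "nat \<Rightarrow> nat \<Rightarrow> nat"
  have ex: "\<exists>q R S. ok m q R S" for m
  proof -
    \<comment> \<open>Kuhn's lemma demands label 0 on the face \<open>r i = 0\<close> and label 1 on
      the face \<open>r i = Suc m\<close>. These rules override the comparison, yet both labels keep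
      their meaning because \<open>f\<close> takes values in the unit interval.\<close>
    define label :: "(nat \<Rightarrow> nat) \<Rightarrow> nat \<Rightarrow> nat" where "label r i =
      (if r i \<noteq> Suc m \<and> (r i = 0 \<or> pt m r i \<le> f (pt m r) i) then 0 else 1)" for r i
    have l0: "pt m r i \<le> f (pt m r) i" if "\<forall>j<n. r j \<le> Suc m" "i < n" "label r i = 0" for r i
      using range[OF pt_C[OF that(1)] that(2)] that
      by (auto simp: label_def pt_def split: if_splits)
    have l1: "f (pt m r) i \<le> pt m r i" if "\<forall>j<n. r j \<le> Suc m" "i < n" "label r i \<noteq> 0" for r i
      using range[OF pt_C[OF that(1)] that(2)] that
      by (auto simp: label_def pt_def split: if_splits)
    obtain q where q: "\<forall>i<n. q i < Suc m" and
      rs: "\<forall>i<n. \<exists>r s. (\<forall>j<n. q j \<le> r j \<and> r j \<le> q j + 1) \<and>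
                 (\<forall>j<n. q j \<le> s j \<and> s j \<le> q j + 1) \<and> label r i \<noteq> label s i"
      by (rule kuhn_lemma[of "Suc m" n label]) (auto simp: label_def)
    have "\<exists>r s. (\<forall>j<n. q j \<le> r j \<and> r j \<le> q j + 1 \<and> r j \<le> Suc m) \<and>
             (\<forall>j<n. q j \<le> s j \<and> s j \<le> q j + 1 \<and> s j \<le> Suc m) \<and>
             pt m r i \<le> f (pt m r) i \<and> f (pt m s) i \<le> pt m s i" if i: "i < n" for i
    proof -
      obtain r s where r: "\<forall>j<n. q j \<le> r j \<and> r j \<le> q j + 1"
        and s: "\<forall>j<n. q j \<le> s j \<and> s j \<le> q j + 1" and ne: "label r i \<noteq> label s i"
        using rs i by blast
      have r': "\<forall>j<n. r j \<le> Suc m" and s': "\<forall>j<n. s j \<le> Suc m"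
        using r s q by (fastforce simp: Suc_le_eq)+
      show ?thesis
      \<comment> \<open>The vertex with label 0 serves as \<open>R i\<close>, the other one as
        \<open>S i\<close>.\<close>
      proof (cases "label r i = 0")
        case True
        then have "label s i \<noteq> 0" using ne by simp
        with True show ?thesis using r s r' s' l0[OF r' i] l1[OF s' i] by blast
      next
        case False
        then have "label s i = 0" using ne by (auto simp: label_def split: if_splits)
        with False show ?thesis using r s r' s' l0[OF s' i] l1[OF r' i] by blast
      qed
    qed
    then obtain R S where "\<forall>i<n. (\<forall>j<n. q j \<le> R i j \<and> R i j \<le> q j + 1 \<and> R i j \<le> Suc m) \<and>
             (\<forall>j<n. q j \<le> S i j \<and> S i j \<le> q j + 1 \<and> S i j \<le> Suc m) \<and>
             pt m (R i) i \<le> f (pt m (R i)) i \<and> f (pt m (S i)) i \<le> pt m (S i) i"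
      by metis
    then show ?thesis using q by (intro exI[of _ q] exI[of _ R] exI[of _ S]) (auto simp: ok_def less_imp_le)
  qed
  obtain Q R S where ok: "\<And>m. ok m (Q m) (R m) (S m)"
    using ex by metis
  have Q: "Q m i \<le> Suc m" if "i < n" for m i
    using ok[of m] that unfolding ok_def by blast
  have R: "Q m j \<le> R m i j \<and> R m i j \<le> Q m j + 1 \<and> R m i j \<le> Suc m"
    and S: "Q m j \<le> S m i j \<and> S m i j \<le> Q m j + 1 \<and> S m i j \<le> Suc m"
    if "i < n" "j < n" for m i j
    using ok[of m] that unfolding ok_def by blast+
  have fR: "pt m (R m i) i \<le> f (pt m (R m i)) i" and fS: "f (pt m (S m i)) i \<le> pt m (S m i) i"
    if "i < n" for m i
    using ok[of m] that unfolding ok_def by blast+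
  \<comment> \<open>The index type is countable, so the product is first countable and compactness
    yields a convergent subsequence of the cell corners.\<close>
  have "seq_compact ?C"
    by (rule compact_imp_seq_compact[OF compact_unit_cube])
  then obtain x \<sigma> where x: "x \<in> ?C" and \<sigma>: "strict_mono (\<sigma> :: nat \<Rightarrow> nat)"
    and lim: "((\<lambda>m. pt m (Q m)) \<circ> \<sigma>) \<longlonglongrightarrow> x"
    unfolding seq_compact_def using pt_C Q by metis
  have limj: "(\<lambda>m. pt (\<sigma> m) (Q (\<sigma> m)) j) \<longlonglongrightarrow> x j" for j
    using tendsto_compose[OF _ lim, of "\<lambda>y. y j"] continuous_on_product_coordinates[of j]
    by (auto simp: o_def continuous_on_def)
  have inv: "(\<lambda>m. 1 / real (Suc (\<sigma> m))) \<longlonglongrightarrow> 0"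
    using LIMSEQ_subseq_LIMSEQ[OF LIMSEQ_inverse_real_of_nat \<sigma>] by (simp add: o_def inverse_eq_divide)
  \<comment> \<open>Vertices of a cell lie within one mesh of its corner in every coordinate, so
    they share its limit.\<close>
  have near: "(\<lambda>m. pt (\<sigma> m) (V (\<sigma> m))) \<longlonglongrightarrow> x"
    if V: "\<And>m j. j < n \<Longrightarrow> Q m j \<le> V m j \<and> V m j \<le> Q m j + 1" for V
  proof (rule tendsto_fun_componentwise)
    fix j
    have b: "pt m (Q m) j \<le> pt m (V m) j \<and> pt m (V m) j \<le> pt m (Q m) j + 1 / real (Suc m)" for m
      using V[of j m] by (auto simp: pt_def divide_simps)
    show "(\<lambda>m. pt (\<sigma> m) (V (\<sigma> m)) j) \<longlonglongrightarrow> x j"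
      by (rule tendsto_sandwich[OF _ _ limj tendsto_add[OF limj inv, simplified]]) (use b in auto)
  qed
  \<comment> \<open>Continuity of \<open>f\<close> carries the inequalities at the vertices
    \<open>S\<close> and \<open>R\<close> to the two opposite inequalities at
    \<open>x\<close>.\<close>
  have "f x i = x i" if i: "i < n" for i
  proof (rule antisym)
    have eval: "((\<lambda>y. y i) \<longlongrightarrow> x i) (at x)"
      using continuous_on_product_coordinates[of i] by (auto simp: continuous_on_def)
    have SC: "pt m (S m i) \<in> ?C" and RC: "pt m (R m i) \<in> ?C" for m
      using S[OF i] R[OF i] by (auto intro!: pt_C)
    have limS: "(\<lambda>m. pt (\<sigma> m) (S (\<sigma> m) i)) \<longlonglongrightarrow> x" and limR: "(\<lambda>m. pt (\<sigma> m) (R (\<sigma> m) i)) \<longlonglongrightarrow> x"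
      using S[OF i] R[OF i] by (auto intro!: near)
    show "f x i \<le> x i"
      by (rule LIMSEQ_le[OF continuous_on_tendsto_compose[OF cont[OF i] limS x]
            tendsto_compose[OF eval limS]]) (use SC fS[OF i] in auto)
    show "x i \<le> f x i"
      by (rule LIMSEQ_le[OF tendsto_compose[OF eval limR]
            continuous_on_tendsto_compose[OF cont[OF i] limR x]]) (use RC fR[OF i] in auto)
  qed
  with x show ?thesis by (rule that)
qed

section \<open>Ky Fan's inequality\<close>

lemma continuous_on_coordinate [continuous_intros]:
  "continuous_on S (\<lambda>x. x i :: 'b::topological_space)"
  by (rule continuous_on_subset[OF continuous_on_product_coordinates]) simp

text \<open>If every \<^term>\<open>x\<close> had some \<^term>\<open>y\<close> with \<^term>\<open>\<phi> x y > 0\<close>, then finitely many such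
  \<^term>\<open>y\<close> would suffice, and the barycentre of these with weights proportional to the positive
  parts of \<^term>\<open>\<phi> x y\<close> would have a fixed point, where concavity forces \<^term>\<open>\<phi> x x > 0\<close>.\<close>

theorem ky_fan_inequality:
  fixes K :: "('i \<Rightarrow> real) set" and \<phi> :: "('i \<Rightarrow> real) \<Rightarrow> ('i \<Rightarrow> real) \<Rightarrow> real"
  assumes K: "compact K" "K \<noteq> {}"
    and convex: "\<And>(n::nat) w y. (\<And>k. k < n \<Longrightarrow> 0 \<le> w k) \<Longrightarrow> (\<And>k. k < n \<Longrightarrow> y k \<in> K) \<Longrightarrow>
        (\<Sum>k<n. w k) = 1 \<Longrightarrow> (\<lambda>i. \<Sum>k<n. w k * y k i) \<in> K"
    and cont: "\<And>y. y \<in> K \<Longrightarrow> continuous_on K (\<lambda>x. \<phi> x y)"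
    and concave: "\<And>(n::nat) w x y. x \<in> K \<Longrightarrow> (\<And>k. k < n \<Longrightarrow> 0 \<le> w k) \<Longrightarrow> (\<And>k. k < n \<Longrightarrow> y k \<in> K) \<Longrightarrow>
        (\<Sum>k<n. w k) = 1 \<Longrightarrow> (\<Sum>k<n. w k * \<phi> x (y k)) \<le> \<phi> x (\<lambda>i. \<Sum>k<n. w k * y k i)"
    and diag: "\<And>x. x \<in> K \<Longrightarrow> \<phi> x x \<le> 0"
  shows "\<exists>x\<in>K. \<forall>y\<in>K. \<phi> x y \<le> 0"
proof (rule ccontr)
  assume "\<not> ?thesis"
  then have pos: "\<exists>y\<in>K. 0 < \<phi> x y" if "x \<in> K" for x
    using that by (meson not_le)
  \<comment> \<open>Positivity is an open condition only relative to \<open>K\<close>; the finite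
    subcover is extracted from open sets of the whole space.\<close>
  have "\<exists>A. open A \<and> A \<inter> K = {x \<in> K. 0 < \<phi> x y}" if "y \<in> K" for y
    using open_Collect_less_Int[OF continuous_on_const cont[OF that]] .
  then obtain A where A: "\<And>y. y \<in> K \<Longrightarrow> open (A y)"
    "\<And>y. y \<in> K \<Longrightarrow> A y \<inter> K = {x \<in> K. 0 < \<phi> x y}"
    by metis
  have cover: "K \<subseteq> (\<Union>y\<in>K. A y)"
  proof
    fix x assume x: "x \<in> K"
    then obtain y where "y \<in> K" "0 < \<phi> x y" using pos by blast
    then have "x \<in> A y \<inter> K" using x by (simp add: A(2))
    then show "x \<in> (\<Union>y\<in>K. A y)" using \<open>y \<in> K\<close> by blast
  qed
  obtain D where D: "D \<subseteq> K" "finite D" "K \<subseteq> (\<Union>y\<in>D. A y)"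
    by (rule compactE_image[OF K(1) _ cover]) (use A(1) in auto)
  obtain Y where Y: "bij_betw Y {0..<card D} D"
    using ex_bij_betw_nat_finite[OF D(2)] by blast
  define n where "n = card D"
  have YK: "Y k \<in> K" if "k < n" for k
    using Y D(1) that by (auto simp: n_def bij_betw_def)
  have Ypos: "\<exists>k<n. 0 < \<phi> x (Y k)" if x: "x \<in> K" for x
  proof -
    obtain y where "y \<in> D" "x \<in> A y" using D(3) x by blast
    moreover from \<open>y \<in> D\<close> obtain k where "k < n" "y = Y k"
      using Y unfolding n_def bij_betw_def by (metis imageE atLeastLessThan_iff)
    moreover have "A y \<inter> K = {x \<in> K. 0 < \<phi> x y}"
      using \<open>y \<in> D\<close> D(1) by (intro A(2)) auto
    ultimately show ?thesis using x by blast
  qed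
  have n: "0 < n" using K(2) Ypos by fastforce
  define p where "p k x = max 0 (\<phi> x (Y k))" for k x
  define s where "s x = (\<Sum>k<n. p k x)" for x
  have p0: "0 \<le> p k x" for k x by (simp add: p_def)
  have s: "0 < s x" if x: "x \<in> K" for x
  proof -
    obtain k where "k < n" "0 < \<phi> x (Y k)" using Ypos[OF x] by blast
    then show ?thesis unfolding s_def
      by (intro sum_pos2[of _ k]) (auto simp: p_def)
  qed
  define S where "S w = (\<Sum>k<n. w k)" for w :: "nat \<Rightarrow> real"
  \<comment> \<open>A continuous retraction of the cube onto the simplex of weights: a deficit of
    the total is spread evenly over the \<open>n\<close> weights, an excess is scaled away.
    Brouwer's theorem for the cube then suffices.\<close>
  define ret where "ret w k = (w k + max 0 (1 - S w) / n) / max 1 (S w)" for w k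
  define X where "X w = (\<lambda>i. \<Sum>k<n. ret w k * Y k i)" for w
  let ?C = "UNIV \<rightarrow> {0..1} :: (nat \<Rightarrow> real) set"
  have ret0: "0 \<le> ret w k" if "w \<in> ?C" for w k
    using that unfolding ret_def by (intro divide_nonneg_nonneg add_nonneg_nonneg) auto
  have ret1: "(\<Sum>k<n. ret w k) = 1" for w
  proof -
    have "(\<Sum>k<n. ret w k) = (S w + max 0 (1 - S w)) / max 1 (S w)"
      using n by (simp add: ret_def S_def sum_divide_distrib[symmetric] sum.distrib)
    also have "\<dots> = 1" by (auto simp: max_def)
    finally show ?thesis .
  qed
  have XK: "X w \<in> K" if "w \<in> ?C" for w
    unfolding X_def by (rule convex[of n "ret w" Y]) (use ret0[OF that] ret1 YK in auto)
  have "max 1 c \<noteq> (0::real)" for c by (simp add: max_def)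
  then have contX: "continuous_on ?C X"
    unfolding X_def ret_def S_def
    by (intro continuous_on_coordinatewise_then_product continuous_intros) simp_all
  have contpX: "continuous_on ?C (\<lambda>w. p k (X w))" if "k < n" for k
  proof -
    have "continuous_on ?C (\<lambda>w. \<phi> (X w) (Y k))"
      by (rule continuous_on_compose2[OF cont[OF YK[OF that]] contX]) (use XK in blast)
    then show ?thesis
      unfolding p_def by (intro continuous_on_max continuous_on_const)
  qed
  obtain w where w: "w \<in> ?C" and fix_w: "\<And>k. k < n \<Longrightarrow> p k (X w) / s (X w) = w k"
  proof (rule brouwer_unit_cube_fun[of n "\<lambda>w k. p k (X w) / s (X w)"])
    show "continuous_on ?C (\<lambda>w. p k (X w) / s (X w))" if "k < n" for k
    proof (rule continuous_on_divide[OF contpX[OF that]])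
      show "continuous_on ?C (\<lambda>w. s (X w))"
        unfolding s_def by (intro continuous_on_sum contpX) simp
      show "\<forall>w\<in>?C. s (X w) \<noteq> 0"
        using s[OF XK] by (metis less_irrefl)
    qed
    show "p k (X w) / s (X w) \<in> {0..1}" if "w \<in> ?C" "k < n" for w k
    proof -
      have "p k (X w) \<le> s (X w)"
        unfolding s_def using that(2) p0 by (intro member_le_sum) auto
      then show ?thesis using s[OF XK[OF that(1)]] p0 by auto
    qed
  qed (rule that)
  have x: "X w \<in> K" by (rule XK[OF w])
  \<comment> \<open>The normalised positive parts sum to 1, so the fixed point lies in the simplex,
    where \<open>ret\<close> is the identity.\<close>
  have "S w = (\<Sum>k<n. p k (X w) / s (X w))"
    unfolding S_def by (rule sum.cong) (simp_all add: fix_w)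
  also have "\<dots> = 1"
    using s[OF x] by (simp add: s_def sum_divide_distrib[symmetric])
  finally have "S w = 1" .
  then have X_eq: "X w = (\<lambda>i. \<Sum>k<n. w k * Y k i)"
    by (simp add: X_def ret_def)
  \<comment> \<open>The weight of \<open>Y k\<close> vanishes where
    \<open>\<phi> (X w) (Y k)\<close> is negative, so no term of the weighted sum is
    negative.\<close>
  have sq: "w k * \<phi> (X w) (Y k) = (p k (X w))\<^sup>2 / s (X w)" if "k < n" for k
    using fix_w[OF that, symmetric] by (auto simp: p_def max_def power2_eq_square)
  obtain k where k: "k < n" "0 < \<phi> (X w) (Y k)" using Ypos[OF x] by blast
  have "0 < (\<Sum>k<n. w k * \<phi> (X w) (Y k))"
    using k s[OF x] by (intro sum_pos2[of _ k]) (auto simp: sq p_def)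
  also have "\<dots> \<le> \<phi> (X w) (X w)"
    using concave[OF x, of n w Y] YK w \<open>S w = 1\<close> by (auto simp: X_eq[symmetric] S_def Pi_iff)
  finally show False using diag[OF x] by simp
qed

section \<open>Convex and monotone functionals\<close>

text \<open>Jensen's inequality for finite combinations: the last weight is split off and the others
  are renormalised.\<close>

lemma convex_functional_sum_le:
  fixes \<rho> :: "('b \<Rightarrow> real) \<Rightarrow> real" and w :: "nat \<Rightarrow> real"
  assumes convex: "\<And>L1 L2 \<alpha>. 0 \<le> \<alpha> \<Longrightarrow> \<alpha> \<le> 1 \<Longrightarrow>
      \<rho> (\<lambda>x. (1 - \<alpha>) * L1 x + \<alpha> * L2 x) \<le> (1 - \<alpha>) * \<rho> L1 + \<alpha> * \<rho> L2"
    and "\<And>k. k < n \<Longrightarrow> 0 \<le> w k" "(\<Sum>k<n. w k) = 1"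
  shows "\<rho> (\<lambda>x. \<Sum>k<n. w k * L k x) \<le> (\<Sum>k<n. w k * \<rho> (L k))"
  using assms(2,3)
proof (induction n arbitrary: w)
  case (Suc n)
  have nn: "0 \<le> (\<Sum>k<n. w k)" using Suc.prems(1) by (intro sum_nonneg) auto
  show ?case
  proof (cases "w n = 1")
    \<comment> \<open>The remaining weights cannot be renormalised here, but they all
      vanish.\<close>
    case True
    then have "(\<Sum>k<n. w k) = 0" using Suc.prems(2) by simp
    then have "w k = 0" if "k < n" for k
      using Suc.prems(1) that by (subst (asm) sum_nonneg_eq_0_iff) auto
    then show ?thesis using True by simp
  next
    case False
    define \<alpha> where "\<alpha> = w n"
    have \<alpha>: "0 \<le> \<alpha>" "\<alpha> < 1" using False Suc.prems nn by (auto simp: \<alpha>_def)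
    have w: "w k = (1 - \<alpha>) * (w k / (1 - \<alpha>))" for k using \<alpha> by simp
    have "\<rho> (\<lambda>x. \<Sum>k<Suc n. w k * L k x)
        = \<rho> (\<lambda>x. (1 - \<alpha>) * (\<Sum>k<n. w k / (1 - \<alpha>) * L k x) + \<alpha> * L n x)"
      unfolding sum_distrib_left mult.assoc[symmetric] w[symmetric] by (simp add: \<alpha>_def)
    also have "\<dots> \<le> (1 - \<alpha>) * \<rho> (\<lambda>x. \<Sum>k<n. w k / (1 - \<alpha>) * L k x) + \<alpha> * \<rho> (L n)"
      using \<alpha> by (intro convex) auto
    also have "\<dots> \<le> (1 - \<alpha>) * (\<Sum>k<n. w k / (1 - \<alpha>) * \<rho> (L k)) + \<alpha> * \<rho> (L n)"
    proof -
      have "(\<Sum>k<n. w k / (1 - \<alpha>)) = 1"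
        using Suc.prems(2) \<alpha> by (simp add: \<alpha>_def sum_divide_distrib[symmetric])
      then show ?thesis
        using \<alpha> Suc.prems(1) by (intro add_right_mono mult_left_mono Suc.IH) auto
    qed
    also have "\<dots> = (\<Sum>k<Suc n. w k * \<rho> (L k))"
      unfolding sum_distrib_left mult.assoc[symmetric] w[symmetric] by (simp add: \<alpha>_def)
    finally show ?thesis .
  qed
qed simp

text \<open>Monotonicity sandwiches \<^term>\<open>\<rho> (L x)\<close> between the values of \<^term>\<open>\<rho>\<close> at two constant shifts
  of \<^term>\<open>L x0\<close>, which reduces continuity to that of a convex function of one real variable.\<close>

lemma continuous_on_monotone_convex_functional:
  fixes \<rho> :: "('b \<Rightarrow> real) \<Rightarrow> real" and L :: "'c::topological_space \<Rightarrow> 'b \<Rightarrow> real"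
  assumes mono: "\<And>L1 L2. (\<And>t. t \<in> T \<Longrightarrow> L1 t \<le> L2 t) \<Longrightarrow> \<rho> L1 \<le> \<rho> L2"
    and convex: "\<And>L1 L2 \<alpha>. 0 \<le> \<alpha> \<Longrightarrow> \<alpha> \<le> 1 \<Longrightarrow>
      \<rho> (\<lambda>x. (1 - \<alpha>) * L1 x + \<alpha> * L2 x) \<le> (1 - \<alpha>) * \<rho> L1 + \<alpha> * \<rho> L2"
    and T: "finite T"
    and cont: "\<And>t. t \<in> T \<Longrightarrow> continuous_on K (\<lambda>x. L x t)"
  shows "continuous_on K (\<lambda>x. \<rho> (L x))"
  unfolding continuous_on_def
proof
  fix x0 assume x0: "x0 \<in> K"
  define h where "h c = \<rho> (\<lambda>t. L x0 t + c)" for c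
  \<comment> \<open>A sum over the finite set \<open>T\<close> dominates the change at each
    \<open>t\<close>, is continuous in \<open>x\<close> and vanishes at \<open>x0\<close>; hence it
    can serve as the constant shift.\<close>
  define e where "e x = (\<Sum>t\<in>T. \<bar>L x t - L x0 t\<bar>)" for x
  have "convex_on UNIV h"
  proof (rule convex_onI)
    fix \<alpha> c d :: real assume "0 < \<alpha>" "\<alpha> < 1"
    then have "\<rho> (\<lambda>t. (1 - \<alpha>) * (L x0 t + c) + \<alpha> * (L x0 t + d)) \<le> (1 - \<alpha>) * h c + \<alpha> * h d"
      unfolding h_def by (intro convex) auto
    then show "h ((1 - \<alpha>) *\<^sub>R c + \<alpha> *\<^sub>R d) \<le> (1 - \<alpha>) * h c + \<alpha> * h d"
      by (simp add: h_def algebra_simps)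
  qed simp
  then have "continuous_on UNIV h" by (intro convex_on_continuous) auto
  then have h: "(h \<longlongrightarrow> h 0) (at 0)" by (auto simp: continuous_on_def)
  have e: "(e \<longlongrightarrow> 0) (at x0 within K)"
  proof -
    have "continuous_on K e" unfolding e_def by (intro continuous_intros cont)
    then have "(e \<longlongrightarrow> e x0) (at x0 within K)" using x0 by (auto simp: continuous_on_def)
    then show ?thesis by (simp add: e_def)
  qed
  have bound: "\<bar>L x t - L x0 t\<bar> \<le> e x" if "t \<in> T" for x t
    unfolding e_def using T that by (intro member_le_sum) auto
  have upper: "\<rho> (L x) \<le> h (e x)" for x
    unfolding h_def using bound[of _ x] by (intro mono) (smt (verit))
  have lower: "h (- e x) \<le> \<rho> (L x)" for x
    unfolding h_def using bound[of _ x] by (intro mono) (smt (verit))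
  have "((\<lambda>x. \<rho> (L x)) \<longlongrightarrow> h 0) (at x0 within K)"
  proof (rule tendsto_sandwich[OF _ _ tendsto_compose[OF h] tendsto_compose[OF h]])
    show "((\<lambda>x. - e x) \<longlongrightarrow> 0) (at x0 within K)" using tendsto_minus[OF e] by simp
  qed (use upper lower e in auto)
  then show "((\<lambda>x. \<rho> (L x)) \<longlongrightarrow> \<rho> (L x0)) (at x0 within K)" by (simp add: h_def)
qed

section \<open>Strategy profiles as probability tables\<close>

definition coords :: "('t, 'a) game \<Rightarrow> (nat \<times> 't \<times> 'a) set" where
  "coords G = {(i, t, a). i \<in> players G \<and> t \<in> type_set G i \<and> a \<in> act_set G i}"

text \<open>Strategy profiles as probability tables \<^term>\<open>z (i, t, a)\<close>, so that they form a compact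
  convex set of real functions.\<close>

definition strategy_tables :: "('t, 'a) game \<Rightarrow> (nat \<times> 't \<times> 'a \<Rightarrow> real) set" where
  "strategy_tables G = {z. (\<forall>p. 0 \<le> z p) \<and> (\<forall>p. p \<notin> coords G \<longrightarrow> z p = 0) \<and>
     (\<forall>i t. i \<in> players G \<and> t \<in> type_set G i \<longrightarrow> (\<Sum>a\<in>act_set G i. z (i, t, a)) = 1)}"

text \<open>The polynomial extension of \<open>random_loss\<close> to arbitrary real tables, for
  which continuity is immediate.\<close>

definition table_loss ::
    "('t, 'a) game \<Rightarrow> nat \<Rightarrow> (nat \<times> 't \<times> 'a \<Rightarrow> real) \<Rightarrow> (nat \<Rightarrow> 't) \<Rightarrow> real" where
  "table_loss G i z t = (\<Sum>a\<in>act_profiles G. loss G i t a * (\<Prod>j\<in>players G. z (j, t j, a j)))"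

text \<open>Only the entries of player \<open>i\<close> in \<open>y\<close> are read, so a single
  table \<open>y\<close> encodes one deviation for each player, as the Nikaido--Isoda function
  requires.\<close>

definition deviate :: "nat \<Rightarrow> (nat \<times> 'b \<Rightarrow> real) \<Rightarrow> (nat \<times> 'b \<Rightarrow> real) \<Rightarrow> nat \<times> 'b \<Rightarrow> real" where
  "deviate i z y = (\<lambda>p. if fst p = i then y p else z p)"

definition strategy_of_table ::
    "('t, 'a) game \<Rightarrow> (nat \<times> 't \<times> 'a \<Rightarrow> real) \<Rightarrow> nat \<Rightarrow> 't \<Rightarrow> 'a pmf" where
  "strategy_of_table G z = (\<lambda>i\<in>players G. \<lambda>t\<in>type_set G i. embed_pmf (\<lambda>a. z (i, t, a)))"

text \<open>The player index \<open>j\<close> is ignored: the table is used only through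
  \<open>deviate i\<close>, which reads the entries with \<open>j = i\<close>.\<close>

definition table_of_strategy ::
    "('t, 'a) game \<Rightarrow> nat \<Rightarrow> ('t \<Rightarrow> 'a pmf) \<Rightarrow> nat \<times> 't \<times> 'a \<Rightarrow> real" where
  "table_of_strategy G i b = (\<lambda>(j, t, a). if (i, t, a) \<in> coords G then pmf (b t) a else 0)"

lemma finite_players: "finite (players G)"
  by (simp add: players_def)

lemma strategy_tablesD:
  assumes "z \<in> strategy_tables G"
  shows "0 \<le> z p" "p \<notin> coords G \<Longrightarrow> z p = 0"
    "i \<in> players G \<Longrightarrow> t \<in> type_set G i \<Longrightarrow> (\<Sum>a\<in>act_set G i. z (i, t, a)) = 1"
  using assms unfolding strategy_tables_def by blast+

lemma deviate_self [simp]: "deviate i z z = z"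
  by (simp add: deviate_def)

text \<open>Together with the next lemma, this reduces the Nikaido--Isoda sum to the gain of a
  single deviating player.\<close>

lemma deviate_deviate_other: "j \<noteq> i \<Longrightarrow> deviate j z (deviate i z y) = z"
  by (auto simp: deviate_def)

lemma deviate_deviate_same: "deviate i z (deviate i z y) = deviate i z y"
  by (auto simp: deviate_def)

text \<open>On a finite discrete space every function is measurable and bounded by the sum of its
  absolute values, so the side conditions in the risk axioms disappear.\<close>

lemma Linf_eq_UNIV:
  assumes "finite (space M)" "sets M = Pow (space M)"
  shows "Linf M = UNIV"
proof -
  have "f \<in> Linf M" for f :: "'a \<Rightarrow> real"
  proof -
    have "\<bar>f x\<bar> \<le> (\<Sum>x\<in>space M. \<bar>f x\<bar>)" if "x \<in> space M" for x
      using assms(1) that by (intro member_le_sum) auto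
    then have "AE x in M. \<bar>f x\<bar> \<le> (\<Sum>x\<in>space M. \<bar>f x\<bar>)"
      by (rule AE_I2)
    moreover have "f \<in> borel_measurable M"
      using assms(2) by (auto simp: measurable_def)
    ultimately show ?thesis unfolding Linf_def by blast
  qed
  then show ?thesis by blast
qed

context
  fixes G :: "('t, 'a) game"
  assumes G: "risk_averse_game G"
begin

lemma finite_sets:
  assumes "i \<in> players G"
  shows "finite (type_set G i)" "finite (act_set G i)" "act_set G i \<noteq> {}"
  using G assms by (auto simp: risk_averse_game_def)

lemma finite_type_profiles: "finite (type_profiles G)"
  unfolding type_profiles_def by (intro finite_PiE finite_players finite_sets)

text \<open>Each entry is bounded by its row sum 1, so the tables form a closed subset of a
  Tychonoff cube, even when the ambient types are infinite.\<close>

lemma compact_strategy_tables: "compact (strategy_tables G)"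
proof -
  have le1: "z p \<le> 1" if z: "z \<in> strategy_tables G" for z p
  proof (cases "p \<in> coords G")
    case True
    then obtain i t a where p: "p = (i, t, a)" "i \<in> players G" "t \<in> type_set G i" "a \<in> act_set G i"
      by (auto simp: coords_def)
    have "z (i, t, a) \<le> (\<Sum>a\<in>act_set G i. z (i, t, a))"
      using p finite_sets(2) z by (intro member_le_sum[of a]) (auto simp: strategy_tables_def)
    then show ?thesis using p z by (simp add: strategy_tables_def)
  next
    case False
    then show ?thesis using strategy_tablesD(2)[OF z] by simp
  qed
  have "closed (strategy_tables G)"
    unfolding strategy_tables_def
    by (intro closed_Collect_conj closed_Collect_all closed_Collect_imp closed_Collect_le
        closed_Collect_eq continuous_intros) auto
  then have "compact ((UNIV \<rightarrow> {0..1}) \<inter> strategy_tables G)"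
    by (intro compact_Int_closed compact_unit_cube)
  moreover have "(UNIV \<rightarrow> {0..1}) \<inter> strategy_tables G = strategy_tables G"
    using le1 by (auto simp: strategy_tables_def)
  ultimately show ?thesis by simp
qed

lemma strategy_tables_nonempty: "strategy_tables G \<noteq> {}"
proof -
  \<comment> \<open>The witness lets every player mix uniformly at every type.\<close>
  have "(\<lambda>p. if p \<in> coords G then 1 / real (card (act_set G (fst p))) else 0) \<in> strategy_tables G"
    using finite_sets by (auto simp: strategy_tables_def coords_def)
  then show ?thesis by blast
qed

lemma convex_strategy_tables:
  fixes w :: "nat \<Rightarrow> real"
  assumes "\<And>k. k < n \<Longrightarrow> 0 \<le> w k" "\<And>k. k < n \<Longrightarrow> y k \<in> strategy_tables G" "(\<Sum>k<n. w k) = 1"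
  shows "(\<lambda>p. \<Sum>k<n. w k * y k p) \<in> strategy_tables G"
proof -
  have "(\<Sum>a\<in>act_set G i. \<Sum>k<n. w k * y k (i, t, a)) = 1"
    if "i \<in> players G" "t \<in> type_set G i" for i t
  proof -
    have "(\<Sum>a\<in>act_set G i. \<Sum>k<n. w k * y k (i, t, a))
        = (\<Sum>k<n. w k * (\<Sum>a\<in>act_set G i. y k (i, t, a)))"
      by (subst sum.swap) (simp add: sum_distrib_left)
    also have "\<dots> = (\<Sum>k<n. w k)"
      using assms(2) that by (intro sum.cong) (auto simp: strategy_tables_def)
    finally show ?thesis using assms(3) by simp
  qed
  then show ?thesis
    using assms(1,2) by (auto simp: strategy_tables_def intro!: sum_nonneg sum.neutral)
qed

text \<open>Each product contains exactly one entry of player \<open>i\<close>, so the loss is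
  linear in the deviation \<open>y\<close>.\<close>

lemma table_loss_deviate:
  assumes i: "i \<in> players G"
  shows "table_loss G i' (deviate i z y) t =
    (\<Sum>a\<in>act_profiles G. loss G i' t a * (\<Prod>j\<in>players G - {i}. z (j, t j, a j)) * y (i, t i, a i))"
proof -
  have "(\<Prod>j\<in>players G. deviate i z y (j, t j, a j))
      = y (i, t i, a i) * (\<Prod>j\<in>players G - {i}. z (j, t j, a j))" for a
    by (subst prod.remove[OF finite_players i]) (auto simp: deviate_def intro!: prod.cong)
  then show ?thesis by (simp add: table_loss_def mult_ac)
qed

lemma table_loss_deviate_sum:
  fixes w :: "nat \<Rightarrow> real"
  assumes i: "i \<in> players G"
  shows "table_loss G i' (deviate i z (\<lambda>p. \<Sum>k<n. w k * y k p)) t =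
    (\<Sum>k<n. w k * table_loss G i' (deviate i z (y k)) t)"
  unfolding table_loss_deviate[OF i] sum_distrib_left
  by (subst sum.swap) (simp add: mult_ac)

text \<open>Tables vanish outside \<open>coords G\<close>, so the total mass over the whole type is
  the row sum over \<open>act_set G i\<close>, which is 1.\<close>

lemma pmf_embed_table:
  assumes z: "z \<in> strategy_tables G" and i: "i \<in> players G" and t: "t \<in> type_set G i"
  shows "pmf (embed_pmf (\<lambda>a. z (i, t, a))) a = z (i, t, a)"
proof (rule pmf_embed_pmf)
  show "0 \<le> z (i, t, a)" for a using z by (simp add: strategy_tables_def)
  have "(\<integral>\<^sup>+ a. ennreal (z (i, t, a)) \<partial>count_space UNIV)
      = (\<integral>\<^sup>+ a. ennreal (z (i, t, a)) \<partial>count_space (act_set G i))"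
    using z by (intro nn_integral_count_space_eq) (auto simp: strategy_tables_def coords_def)
  also have "\<dots> = ennreal (\<Sum>a\<in>act_set G i. z (i, t, a))"
    using z finite_sets(2)[OF i]
    by (simp add: nn_integral_count_space_finite sum_ennreal strategy_tables_def)
  also have "\<dots> = 1" using z i t by (simp add: strategy_tables_def)
  finally show "(\<integral>\<^sup>+ a. ennreal (z (i, t, a)) \<partial>count_space UNIV) = 1" .
qed

lemma strategy_of_table_in:
  assumes "z \<in> strategy_tables G"
  shows "strategy_of_table G z \<in> strategy_profiles G"
proof -
  have "a \<in> act_set G i" if "z (i, t, a) \<noteq> 0" for i t a
    using strategy_tablesD(2)[OF assms, of "(i, t, a)"] that by (auto simp: coords_def)
  then have "set_pmf (embed_pmf (\<lambda>a. z (i, t, a))) \<subseteq> act_set G i"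
    if "i \<in> players G" "t \<in> type_set G i" for i t
    by (auto simp: set_pmf_iff pmf_embed_table[OF assms that])
  then show ?thesis
    by (auto simp: strategy_of_table_def strategy_profiles_def strategies_def)
qed

lemma random_loss_strategy_of_table:
  assumes z: "z \<in> strategy_tables G" and t: "t \<in> type_profiles G"
  shows "random_loss G i (strategy_of_table G z) t = table_loss G i z t"
  using t pmf_embed_table[OF z]
  by (auto simp: random_loss_def table_loss_def strategy_of_table_def type_profiles_def PiE_iff
      intro!: sum.cong prod.cong)

lemma deviate_table_of_strategy_in:
  assumes z: "z \<in> strategy_tables G" and b: "b \<in> strategies G i"
  shows "deviate i z (table_of_strategy G i b) \<in> strategy_tables G"
proof -
  have "(\<Sum>a\<in>act_set G j. deviate i z (table_of_strategy G i b) (j, t, a)) = 1"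
    if j: "j \<in> players G" and t: "t \<in> type_set G j" for j t
  proof (cases "j = i")
    case True
    then have "(\<Sum>a\<in>act_set G j. deviate i z (table_of_strategy G i b) (j, t, a))
        = (\<Sum>a\<in>act_set G i. pmf (b t) a)"
      using j t by (auto simp: deviate_def table_of_strategy_def coords_def intro!: sum.cong)
    also have "\<dots> = 1"
      using True b j t finite_sets(2) by (intro sum_pmf_eq_1) (auto simp: strategies_def)
    finally show ?thesis .
  next
    case False
    then show ?thesis using strategy_tablesD(3)[OF z j t] by (simp add: deviate_def)
  qed
  moreover have "0 \<le> deviate i z (table_of_strategy G i b) p"
    "p \<notin> coords G \<Longrightarrow> deviate i z (table_of_strategy G i b) p = 0" for p
    using strategy_tablesD(1,2)[OF z]
    by (auto simp: deviate_def table_of_strategy_def split: prod.splits)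
  ultimately show ?thesis unfolding strategy_tables_def by blast
qed

lemma random_loss_deviation:
  assumes z: "z \<in> strategy_tables G" and t: "t \<in> type_profiles G" and i: "i \<in> players G"
  shows "random_loss G i ((strategy_of_table G z)(i := b)) t
    = table_loss G i (deviate i z (table_of_strategy G i b)) t"
  unfolding random_loss_def table_loss_def
proof (intro sum.cong prod.cong refl arg_cong2[where f = "(*)"])
  fix a j assume a: "a \<in> act_profiles G" and j: "j \<in> players G"
  have "t j \<in> type_set G j" "a j \<in> act_set G j"
    using a t j by (auto simp: act_profiles_def type_profiles_def PiE_iff)
  then show "pmf (((strategy_of_table G z)(i := b)) j (t j)) (a j)
      = deviate i z (table_of_strategy G i b) (j, t j, a j)"
    using pmf_embed_table[OF z j] j
    by (auto simp: deviate_def table_of_strategy_def coords_def strategy_of_table_def)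
qed

end

section \<open>Existence of an equilibrium\<close>

theorem theorem1:
  fixes G :: "('t, 'a) game"
  assumes "risk_averse_game G"
    and "\<And>i. i \<in> players G \<Longrightarrow> monotone_risk (prior G) (risk G i)"
    and "\<And>i. i \<in> players G \<Longrightarrow> convex_risk (prior G) (risk G i)"
  shows "\<exists>\<beta>. RANE G \<beta>"
proof -
  note G = assms(1)
  have space: "space (prior G) = type_profiles G"
    using G by (simp add: risk_averse_game_def)
  have Linf: "Linf (prior G) = UNIV"
    using G finite_type_profiles[OF G] by (intro Linf_eq_UNIV) (simp_all add: risk_averse_game_def)
  have mono: "risk G i L1 \<le> risk G i L2"
    if "i \<in> players G" "\<And>t. t \<in> type_profiles G \<Longrightarrow> L1 t \<le> L2 t" for i L1 L2
    using assms(2)[OF that(1)] that(2) AE_I2[of "prior G" "\<lambda>t. L1 t \<le> L2 t"]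
    by (auto simp: monotone_risk_def Linf space)
  \<comment> \<open>Losses of strategies and of tables are known to agree only on
    \<open>type_profiles G\<close>; this transfers the agreement to the risks.\<close>
  have cong: "risk G i L1 = risk G i L2"
    if "i \<in> players G" "\<And>t. t \<in> type_profiles G \<Longrightarrow> L1 t = L2 t" for i L1 L2
    using that by (intro antisym mono) auto
  have convex: "risk G i (\<lambda>x. (1 - \<alpha>) * L1 x + \<alpha> * L2 x) \<le> (1 - \<alpha>) * risk G i L1 + \<alpha> * risk G i L2"
    if "i \<in> players G" "0 \<le> \<alpha>" "\<alpha> \<le> 1" for i L1 L2 \<alpha>
    using assms(3)[OF that(1)] that(2,3) by (auto simp: convex_risk_def Linf)
  define cost where "cost i z = risk G i (table_loss G i z)" for i z
  define \<phi> where "\<phi> x y = (\<Sum>i\<in>players G. cost i x - cost i (deviate i x y))" for x y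
  \<comment> \<open>The general map \<open>g\<close> covers both \<open>cost i x\<close> and
    \<open>cost i (deviate i x y)\<close>.\<close>
  have cont: "continuous_on K (\<lambda>x. cost i (g x))"
    if i: "i \<in> players G" and g: "\<And>p. continuous_on K (\<lambda>x. g x p)"
    for i K and g :: "(nat \<times> 't \<times> 'a \<Rightarrow> real) \<Rightarrow> nat \<times> 't \<times> 'a \<Rightarrow> real"
    unfolding cost_def
  proof (rule continuous_on_monotone_convex_functional[where T = "type_profiles G"
        and \<rho> = "risk G i" and L = "\<lambda>x. table_loss G i (g x)"])
    show "continuous_on K (\<lambda>x. table_loss G i (g x) t)" for t
      unfolding table_loss_def
      by (intro continuous_on_sum continuous_on_mult continuous_on_prod continuous_on_const g)
  qed (use mono convex i finite_type_profiles[OF G] in auto)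
  have "\<exists>x\<in>strategy_tables G. \<forall>y\<in>strategy_tables G. \<phi> x y \<le> 0"
  proof (rule ky_fan_inequality)
    fix y
    have "continuous_on (strategy_tables G) (\<lambda>x. deviate i x y p)" for i p
      by (cases "fst p = i") (simp_all add: deviate_def continuous_on_coordinate)
    then show "continuous_on (strategy_tables G) (\<lambda>x. \<phi> x y)"
      unfolding \<phi>_def by (intro continuous_on_sum continuous_on_diff cont continuous_on_coordinate)
  next
    fix n :: nat and w :: "nat \<Rightarrow> real" and x y
    assume w: "\<And>k. k < n \<Longrightarrow> 0 \<le> w k" "(\<Sum>k<n. w k) = 1"
    \<comment> \<open>Linearity in the deviation turns the mixed table into the same mixture of
      random losses, to which Jensen's inequality applies.\<close>
    have "cost i (deviate i x (\<lambda>p. \<Sum>k<n. w k * y k p)) \<le> (\<Sum>k<n. w k * cost i (deviate i x (y k)))"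
      if i: "i \<in> players G" for i
      using convex_functional_sum_le[of "risk G i" n w "\<lambda>k. table_loss G i (deviate i x (y k))",
          OF convex[OF i] w]
      by (simp add: cost_def table_loss_deviate_sum[OF G i, abs_def])
    then have "(\<Sum>i\<in>players G. cost i x - (\<Sum>k<n. w k * cost i (deviate i x (y k))))
        \<le> \<phi> x (\<lambda>p. \<Sum>k<n. w k * y k p)"
      unfolding \<phi>_def by (intro sum_mono) simp
    also have "(\<Sum>i\<in>players G. cost i x - (\<Sum>k<n. w k * cost i (deviate i x (y k))))
        = (\<Sum>i\<in>players G. \<Sum>k<n. w k * (cost i x - cost i (deviate i x (y k))))"
      by (simp add: right_diff_distrib sum_subtractf sum_distrib_right[symmetric] w(2))
    also have "\<dots> = (\<Sum>k<n. w k * \<phi> x (y k))"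
      unfolding \<phi>_def sum_distrib_left by (rule sum.swap)
    finally show "(\<Sum>k<n. w k * \<phi> x (y k)) \<le> \<phi> x (\<lambda>p. \<Sum>k<n. w k * y k p)" .
  qed (use compact_strategy_tables[OF G] strategy_tables_nonempty[OF G] convex_strategy_tables[OF G]
      in \<open>auto simp: \<phi>_def\<close>)
  then obtain z where z: "z \<in> strategy_tables G"
    and le: "\<And>y. y \<in> strategy_tables G \<Longrightarrow> \<phi> z y \<le> 0" by blast
  have "risk G i (random_loss G i (strategy_of_table G z))
      \<le> risk G i (random_loss G i ((strategy_of_table G z)(i := b)))"
    if i: "i \<in> players G" and b: "b \<in> strategies G i" for i b
  proof -
    define y where "y = deviate i z (table_of_strategy G i b)"
    \<comment> \<open>\<open>y\<close> departs from \<open>z\<close> only in the entries of player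
      \<open>i\<close>, so the gains of all other players are zero.\<close>
    have "\<phi> z y = (\<Sum>j\<in>players G. if j = i then cost i z - cost i y else 0)"
      unfolding \<phi>_def y_def
      by (intro sum.cong) (auto simp: deviate_deviate_other deviate_deviate_same)
    also have "\<dots> = cost i z - cost i y"
      using i by (simp add: finite_players)
    finally have "cost i z \<le> cost i y"
      using le[of y] deviate_table_of_strategy_in[OF G z b] by (simp add: y_def)
    moreover have "risk G i (random_loss G i (strategy_of_table G z)) = cost i z"
      unfolding cost_def by (intro cong i random_loss_strategy_of_table[OF G z])
    moreover have "risk G i (random_loss G i ((strategy_of_table G z)(i := b))) = cost i y"
      unfolding cost_def y_def by (intro cong i random_loss_deviation[OF G z])
    ultimately show ?thesis by simp
  qed
  then show ?thesis
    using strategy_of_table_in[OF G z] unfolding RANE_def by blast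
qed

end
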